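(* Let $X$ be a linear space and $(Y,N)$ a fuzzy Banach space. Let $\varphi:X^3\to[0,\infty)$ be a function such that $$\tilde\varphi(x,y,z)=\sum_{n=0}^{\infty}\frac{1}{3^n}\varphi(3^nx,3^ny,3^nz)<\infty\quad\text{for all }x,y,z\in X.$$ Let $f:X\to Y$ be a uniformly approximately affine mapping with respect to $\varphi$, in the sense that $$\lim_{t\to\infty}N(Df(x,y,z),t\varphi(x,y,z))=1\quad\text{uniformly on }X^3.$$ Then $A(x):=N\text{-}\lim_{n\to\infty}\frac{f(3^nx)}{3^n}$ exists for all $x\in X$ and defines an affine mapping $A:X\to Y$ such that, if for some $\alpha>0$ and $\delta>0$ $$N(Df(x,y,z),\delta\varphi(x,y,z))>\alpha\quad\text{for all }x,y,z\in X,$$ then $$N\Bigl(f(x)-A(x)-f(0),\frac{\delta}{3}\tilde\varphi(0,0,x)\Bigr)>\alpha\quad\text{for all }x\in X.$$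
   Context: For a mapping $f:X\to Y$, $$Df(x,y,z)=f(3x+y+z)+f(x+3y+z)+f(x+y+3z)+f(x)+f(y)+f(z)-6f(x+y+z).$$ A mapping between linear spaces is affine if it is the sum of a constant and an additive function (a function $a$ with $a(u+v)=a(u)+a(v)$ for all $u,v$). A fuzzy norm on a real linear space $X$ is a mapping $N:X\times\mathbb{R}\to[0,1]$ such that for all $x,y\in X$ and $s,t\in\mathbb{R}$: (N1) $N(x,t)=0$ for $t\le 0$; (N2) $x=0$ if and only if $N(x,t)=1$ for all $t>0$; (N3) $N(cx,t)=N(x,t/|c|)$ if $c\ne 0$; (N4) $N(x+y,t+s)\ge\min\{N(x,t),N(y,s)\}$; (N5) $N(x,\cdot)$ is non-decreasing on $\mathbb{R}$ and $\lim_{t\to\infty}N(x,t)=1$; (N6) for $x\ne 0$, $N(x,\cdot)$ is continuous on $\mathbb{R}$. The pair $(X,N)$ is then called a fuzzy normed (linear) space. A sequence $\{x_n\}$ in $(X,N)$ is convergent if there is $x\in X$ with $\lim_{n\to\infty}N(x_n-x,t)=1$ for all $t>0$; then $x$ is called its limit, written $N\text{-}\lim_{n\to\infty}x_n=x$. The sequence is Cauchy if for every $\varepsilon>0$ and $\delta>0$ there is $n_0\in\mathbb{N}$ with $N(x_m-x_n,\delta)>1-\varepsilon$ for all $m,n\ge n_0$. A fuzzy Banach space is a fuzzy normed space in which every Cauchy sequence is convergent. The uniform limit on $X^3$ means: for every $\varepsilon>0$ there is $t_0>0$ such that $N(Df(x,y,z),t\varphi(x,y,z))\ge 1-\varepsilon$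 for all $x,y,z\in X$ and all $t\ge t_0$. *)

theory Defs
  imports Complex_Main
begin

locale fuzzy_normed_space =
  fixes N :: "'b::real_vector \<Rightarrow> real \<Rightarrow> real"
  assumes range: "N x t \<in> {0..1}"
    and N1: "t \<le> 0 \<Longrightarrow> N x t = 0"
    and N2: "x = 0 \<longleftrightarrow> (\<forall>t>0. N x t = 1)"
    and N3: "c \<noteq> 0 \<Longrightarrow> N (c *\<^sub>R x) t = N x (t / \<bar>c\<bar>)"
    and N4: "N (x + y) (t + s) \<ge> min (N x t) (N y s)"
    and N5_mono: "mono (N x)"
    and N5_lim: "(N x \<longlongrightarrow> 1) at_top"
    and N6: "x \<noteq> 0 \<Longrightarrow> continuous_on UNIV (N x)"

text \<open>The convergence, Cauchy and limit notions are stated for arbitrary \<open>N\<close>;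
  \<open>fuzzy_tendsto N s l\<close> is the relation $N$-$\lim_{n\to\infty} s_n = l$.\<close>

definition fuzzy_tendsto :: "('b::real_vector \<Rightarrow> real \<Rightarrow> real) \<Rightarrow> (nat \<Rightarrow> 'b) \<Rightarrow> 'b \<Rightarrow> bool"
  where "fuzzy_tendsto N s l \<longleftrightarrow> (\<forall>t>0. (\<lambda>n. N (s n - l) t) \<longlonglongrightarrow> 1)"

definition fuzzy_convergent :: "('b::real_vector \<Rightarrow> real \<Rightarrow> real) \<Rightarrow> (nat \<Rightarrow> 'b) \<Rightarrow> bool"
  where "fuzzy_convergent N s \<longleftrightarrow> (\<exists>l. fuzzy_tendsto N s l)"

definition fuzzy_Cauchy :: "('b::real_vector \<Rightarrow> real \<Rightarrow> real) \<Rightarrow> (nat \<Rightarrow> 'b) \<Rightarrow> bool"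
  where "fuzzy_Cauchy N s \<longleftrightarrow>
    (\<forall>\<epsilon>>0. \<forall>\<delta>>0. \<exists>n0. \<forall>m\<ge>n0. \<forall>n\<ge>n0. N (s m - s n) \<delta> > 1 - \<epsilon>)"

locale fuzzy_banach_space = fuzzy_normed_space +
  assumes complete: "fuzzy_Cauchy N s \<Longrightarrow> fuzzy_convergent N s"

text \<open>Limits are unique, so the relation determines the value of $N$-$\lim$.\<close>

lemma (in fuzzy_normed_space) fuzzy_tendsto_unique:
  assumes "fuzzy_tendsto N s k" "fuzzy_tendsto N s l"
  shows "k = l"
proof -
  have "N (k - l) t = 1" if "t > 0" for t
  proof -
    have t2: "t / 2 > 0" using that by simp
    have "(\<lambda>n. min (N (s n - l) (t/2)) (N (s n - k) (t/2))) \<longlonglongrightarrow> min 1 1"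
      using assms t2 unfolding fuzzy_tendsto_def by (intro tendsto_min) auto
    moreover have "min (N (s n - l) (t/2)) (N (s n - k) (t/2)) \<le> N (k - l) t" for n
    proof -
      have "N (k - s n) (t/2) = N (s n - k) (t/2)"
        using N3[of "-1" "s n - k" "t/2"] by simp
      then show ?thesis
        using N4[of "s n - l" "t/2" "k - s n" "t/2"] by simp
    qed
    ultimately have "1 \<le> N (k - l) t"
      by (intro tendsto_upperbound[of _ 1 sequentially]) auto
    then show ?thesis using range[of "k - l" t] by simp
  qed
  then show ?thesis using N2[of "k - l"] by simp
qed

definition affine_mapping :: "('a::real_vector \<Rightarrow> 'b::real_vector) \<Rightarrow> bool"
  where "affine_mapping A \<longleftrightarrow> (\<exists>c a. additive a \<and> (\<forall>x. A x = c + a x))"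

definition D :: "('a::real_vector \<Rightarrow> 'b::real_vector) \<Rightarrow> 'a \<Rightarrow> 'a \<Rightarrow> 'a \<Rightarrow> 'b"
  where "D f x y z =
    f (3 *\<^sub>R x + y + z) + f (x + 3 *\<^sub>R y + z) + f (x + y + 3 *\<^sub>R z)
      + f x + f y + f z - 6 *\<^sub>R f (x + y + z)"

definition phi_term :: "('a::real_vector \<Rightarrow> 'a \<Rightarrow> 'a \<Rightarrow> real) \<Rightarrow> 'a \<Rightarrow> 'a \<Rightarrow> 'a \<Rightarrow> nat \<Rightarrow> real"
  where "phi_term \<phi> x y z n = 1 / 3 ^ n * \<phi> (3 ^ n *\<^sub>R x) (3 ^ n *\<^sub>R y) (3 ^ n *\<^sub>R z)"

text \<open>Meaningful only where \<open>phi_term \<phi> x y z\<close> is summable.\<close>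

definition phi_tilde :: "('a::real_vector \<Rightarrow> 'a \<Rightarrow> 'a \<Rightarrow> real) \<Rightarrow> 'a \<Rightarrow> 'a \<Rightarrow> 'a \<Rightarrow> real"
  where "phi_tilde \<phi> x y z = (\<Sum>n. phi_term \<phi> x y z n)"

text \<open>$\lim_{t\to\infty} N(Df(x,y,z), t\varphi(x,y,z)) = 1$ uniformly: \<open>t0\<close> depends on \<open>\<epsilon>\<close> only.\<close>

definition uniformly_approx_affine ::
  "('b::real_vector \<Rightarrow> real \<Rightarrow> real) \<Rightarrow> ('a::real_vector \<Rightarrow> 'a \<Rightarrow> 'a \<Rightarrow> real) \<Rightarrow> ('a \<Rightarrow> 'b) \<Rightarrow> bool"
  where "uniformly_approx_affine N \<phi> f \<longleftrightarrow>
    (\<forall>\<epsilon>>0. \<exists>t0>0. \<forall>x y z. \<forall>t\<ge>t0. N (D f x y z) (t * \<phi> x y z) \<ge> 1 - \<epsilon>)"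

end

(* Put g x = f x - f 0. Since D f 0 0 x = g (3 x) - 3 g x, the sequence g (3^n x) / 3^n telescopes,
   and the fuzzy triangle inequality together with the convergence of the series for phi makes it
   Cauchy. Its limit A satisfies D A = 0 and A 0 = 0, which forces A to be additive. For the error
   estimate, continuity of N u (for u nonzero) lets the first step be estimated with a slightly
   smaller parameter; the slack absorbs the distance from g (3^n x) / 3^n to A x, so that the strict
   inequality survives the passage to the limit. *)
theory Submission
  imports Defs
begin

text \<open>Expanding the multiples that occur in \<open>D\<close> into sums reduces later
  identities to abelian group arithmetic.\<close>

lemma scaleR_small_numeral:
  fixes v :: "'a::real_vector"
  shows "2 *\<^sub>R v = v + v" "3 *\<^sub>R v = v + v + v" "5 *\<^sub>R v = v + v + v + v + v"
    "6 *\<^sub>R v = v + v + v + v + v + v"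
proof -
  show *: "2 *\<^sub>R v = v + v" "3 *\<^sub>R v = v + v + v"
    using scaleR_left_distrib[of 2 1 v] by (simp_all add: scaleR_2)
  show "5 *\<^sub>R v = v + v + v + v + v" "6 *\<^sub>R v = v + v + v + v + v + v"
    using scaleR_left_distrib[of 3 2 v] scaleR_left_distrib[of 3 3 v]
    unfolding * by (simp_all add: add.assoc)
qed

section \<open>Consequences of the fuzzy norm axioms\<close>

context fuzzy_normed_space
begin

lemma N_le_1: "N x t \<le> 1"
  using range[of x t] by simp

lemma N_zero: "t > 0 \<Longrightarrow> N 0 t = 1"
  using N2[of 0] by simp

lemma N_mono: "s \<le> t \<Longrightarrow> N x s \<le> N x t"
  using N5_mono by (auto simp: mono_def)

lemma N_minus: "N (- x) t = N x t"
  using N3[of "-1" x t] by simp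

lemma N_add_greater:
  assumes "N x t > \<alpha>" "N y s > \<alpha>"
  shows "N (x + y) (t + s) > \<alpha>"
  using N4[of x t y s] assms by linarith

text \<open>Iterated (N4). The empty sum is excluded because \<open>N 0 0 = 0\<close>, so the bound
  would fail for \<alpha> \<ge> 0.\<close>

lemma N_sum_greater:
  assumes "finite S" "S \<noteq> {}" "\<And>i. i \<in> S \<Longrightarrow> N (u i) (r i) > \<alpha>"
  shows "N (\<Sum>i\<in>S. u i) (\<Sum>i\<in>S. r i) > \<alpha>"
  using assms by (induction S rule: finite_ne_induct) (auto intro: N_add_greater)

text \<open>For \<open>x\<close> nonzero this is left continuity from (N6). The function
  \<open>N 0\<close> jumps at 0, but there \<alpha> > 0 forces \<open>t > 0\<close> and half of
  \<open>t\<close> works.\<close>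

lemma N_greater_shrink:
  assumes "N x t > \<alpha>" "\<alpha> > 0"
  obtains s where "s < t" "N x s > \<alpha>"
proof (cases "x = 0")
  case True
  have "t > 0" using assms N1[of t x] by force
  then have "N x (t / 2) > \<alpha>"
    using True assms N_le_1[of x t] N_zero[of "t / 2"] by simp
  with \<open>t > 0\<close> show ?thesis using that[of "t / 2"] by simp
next
  case False
  have "isCont (N x) t"
    using N6[OF False] by (simp add: continuous_on_eq_continuous_at)
  then have "(N x \<longlongrightarrow> N x t) (at_left t)"
    by (simp add: continuous_at_imp_continuous_at_within flip: continuous_within)
  then have "\<forall>\<^sub>F s in at_left t. N x s > \<alpha>"
    using assms(1) by (rule order_tendstoD)
  moreover have "\<forall>\<^sub>F s in at_left t. s < t"
    by (simp add: eventually_at_filter)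
  ultimately have "\<forall>\<^sub>F s in at_left t. N x s > \<alpha> \<and> s < t"
    by eventually_elim simp
  then show ?thesis
    using that eventually_happens[OF _] trivial_limit_at_left_real by blast
qed

section \<open>Calculus of fuzzy limits\<close>

lemma fuzzy_tendstoI:
  assumes "\<And>t \<epsilon>. t > 0 \<Longrightarrow> \<epsilon> > 0 \<Longrightarrow> \<forall>\<^sub>F n in sequentially. N (s n - l) t > 1 - \<epsilon>"
  shows "fuzzy_tendsto N s l"
  unfolding fuzzy_tendsto_def
proof (intro allI impI order_tendstoI)
  fix t a :: real assume "t > 0" "a < 1"
  then show "\<forall>\<^sub>F n in sequentially. a < N (s n - l) t"
    using assms[of t "1 - a"] by simp
next
  fix t a :: real assume "1 < a"
  then show "\<forall>\<^sub>F n in sequentially. N (s n - l) t < a"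
    using N_le_1 by (intro always_eventually allI) (metis le_less_trans)
qed

lemma fuzzy_tendstoD:
  assumes "fuzzy_tendsto N s l" "t > 0" "\<alpha> < 1"
  shows "\<forall>\<^sub>F n in sequentially. N (s n - l) t > \<alpha>"
  using assms order_tendstoD(1) unfolding fuzzy_tendsto_def by blast

lemma fuzzy_tendsto_add:
  assumes "fuzzy_tendsto N s k" "fuzzy_tendsto N u l"
  shows "fuzzy_tendsto N (\<lambda>n. s n + u n) (k + l)"
proof (rule fuzzy_tendstoI)
  fix t \<epsilon> :: real assume "t > 0" "\<epsilon> > 0"
  then have "\<forall>\<^sub>F n in sequentially. N (s n - k) (t/2) > 1 - \<epsilon>"
    "\<forall>\<^sub>F n in sequentially. N (u n - l) (t/2) > 1 - \<epsilon>"
    using assms by (auto intro: fuzzy_tendstoD)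
  then show "\<forall>\<^sub>F n in sequentially. N (s n + u n - (k + l)) t > 1 - \<epsilon>"
  proof eventually_elim
    case (elim n)
    show ?case using N_add_greater[OF elim] by (simp add: algebra_simps)
  qed
qed

lemma fuzzy_tendsto_scaleR:
  assumes "fuzzy_tendsto N s l"
  shows "fuzzy_tendsto N (\<lambda>n. c *\<^sub>R s n) (c *\<^sub>R l)"
proof (cases "c = 0")
  case True
  then show ?thesis by (simp add: fuzzy_tendsto_def N_zero)
next
  case False
  then show ?thesis
    using assms N3[OF False]
    by (simp add: fuzzy_tendsto_def flip: scaleR_diff_right)
qed

lemma fuzzy_tendsto_diff:
  assumes "fuzzy_tendsto N s k" "fuzzy_tendsto N u l"
  shows "fuzzy_tendsto N (\<lambda>n. s n - u n) (k - l)"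
  using fuzzy_tendsto_add[OF assms(1) fuzzy_tendsto_scaleR[OF assms(2), of "-1"]] by simp

text \<open>By (N3) the factor \<open>c n\<close> moves into the parameter, which becomes
  \<open>t / c n\<close> and tends to infinity, so (N5) applies.\<close>

lemma fuzzy_tendsto_scaleR_null:
  assumes "\<And>n. c n > 0" "c \<longlonglongrightarrow> 0"
  shows "fuzzy_tendsto N (\<lambda>n. c n *\<^sub>R x) 0"
  unfolding fuzzy_tendsto_def
proof (intro allI impI)
  fix t :: real assume "t > 0"
  have "filterlim c (at_right 0) sequentially"
    unfolding filterlim_at using assms by (auto intro!: always_eventually simp: less_le)
  then have "filterlim (\<lambda>n. inverse (c n)) at_top sequentially"
    by (rule filterlim_compose[OF filterlim_inverse_at_top_right])
  then have "filterlim (\<lambda>n. t * inverse (c n)) at_top sequentially"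
    using \<open>t > 0\<close> filterlim_tendsto_pos_mult_at_top[OF tendsto_const] by blast
  then have "(\<lambda>n. N x (t * inverse (c n))) \<longlonglongrightarrow> 1"
    by (rule filterlim_compose[OF N5_lim])
  moreover have "N (c n *\<^sub>R x) t = N x (t * inverse (c n))" for n
    using assms(1)[of n] N3[of "c n" x t] by (simp add: divide_inverse)
  ultimately show "(\<lambda>n. N (c n *\<^sub>R x - 0) t) \<longlonglongrightarrow> 1" by simp
qed

text \<open>The difference telescopes into steps that are values of \<open>D f\<close> scaled by
  \<open>1 / 3 ^ Suc k\<close>, which explains the weights. The bounds \<open>r k\<close> stay free
  so that a single summand can be tightened in the error estimate.\<close>

lemma N_scaled_diff_greater:
  assumes "m < n"
    and "\<And>k. m \<le> k \<Longrightarrow> k < n \<Longrightarrow> N (D f 0 0 (3 ^ k *\<^sub>R x)) (r k) > \<alpha>"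
  shows "N ((1 / 3 ^ n) *\<^sub>R (f (3 ^ n *\<^sub>R x) - f 0) - (1 / 3 ^ m) *\<^sub>R (f (3 ^ m *\<^sub>R x) - f 0))
    (\<Sum>k = m..<n. r k / 3 ^ Suc k) > \<alpha>"
proof -
  define g where "g k = (1 / 3 ^ k) *\<^sub>R (f (3 ^ k *\<^sub>R x) - f 0)" for k :: nat
  have step: "g (Suc k) - g k = (1 / 3 ^ Suc k) *\<^sub>R D f 0 0 (3 ^ k *\<^sub>R x)" for k
  proof -
    \<comment> \<open>Expanding \<open>D f 0 0 u\<close> leaves \<open>2 *\<^sub>R f 0\<close>,
      exactly what subtracting \<open>f 0\<close> from both values of \<open>f\<close>
      absorbs.\<close>
    have D0: "D f 0 0 u = (f (3 *\<^sub>R u) - f 0) - 3 *\<^sub>R (f u - f 0)" for u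
      by (simp add: D_def scaleR_small_numeral)
    have "(1 / 3 ^ Suc k) *\<^sub>R D f 0 0 (3 ^ k *\<^sub>R x)
        = (1 / 3 ^ Suc k) *\<^sub>R (f (3 ^ Suc k *\<^sub>R x) - f 0)
          - (1 / 3 ^ Suc k * 3) *\<^sub>R (f (3 ^ k *\<^sub>R x) - f 0)"
      unfolding D0 by (simp only: scaleR_diff_right scaleR_scaleR power_Suc)
    then show ?thesis by (simp add: g_def)
  qed
  have "(\<Sum>k = m..<n. g (Suc k) - g k) = g n - g m"
    using assms(1) by (simp add: sum_Suc_diff')
  moreover have "N (\<Sum>k = m..<n. g (Suc k) - g k) (\<Sum>k = m..<n. r k / 3 ^ Suc k) > \<alpha>"
    using assms N3[of "1 / 3 ^ Suc k" for k]
    by (intro N_sum_greater) (auto simp: step simp del: power_Suc)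
  ultimately show ?thesis by (simp add: g_def)
qed

end

text \<open>The substitution \<open>y = - x\<close> yields a quadratic-type equation whose defect is
  \<open>A u + A (- u)\<close>. Computing this defect at \<open>2 *\<^sub>R u\<close> in two ways
  kills it; what remains is Jensen's equation for an odd map.\<close>

lemma additive_if_D_eq_0:
  fixes A :: "'a::real_vector \<Rightarrow> 'b::real_vector"
  assumes D0: "\<And>x y z. D A x y z = 0" and A0: "A 0 = 0"
  shows "additive A"
proof -
  have opp: "A (z + 2 *\<^sub>R x) + A (z - 2 *\<^sub>R x) + A (3 *\<^sub>R z) + A x + A (- x) = 5 *\<^sub>R A z" for x z
    using D0[of x "-x" z]
    by (simp add: D_def scaleR_small_numeral algebra_simps)
  have triple: "A (3 *\<^sub>R z) = 3 *\<^sub>R A z" for z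
    using opp[of z 0] A0 by (simp add: scaleR_small_numeral)
  have even_double: "A (2 *\<^sub>R x) + A (- (2 *\<^sub>R x)) = - (A x + A (- x))" for x
    using opp[of 0 x] A0 by (simp add: add_eq_0_iff algebra_simps)
  \<comment> \<open>Apply \<open>opp\<close> with half of \<open>u\<close>;
    \<open>even_double\<close> then trades the defect at \<open>u/2\<close> for minus the defect at
    \<open>u\<close>.\<close>
  have quad: "A (z + u) + A (z - u) = 2 *\<^sub>R A z + (A u + A (- u))" for z u
  proof -
    have "A (z + u) + A (z - u) + (A ((1/2) *\<^sub>R u) + A (- ((1/2) *\<^sub>R u))) = 2 *\<^sub>R A z"
      using opp[of z "(1/2) *\<^sub>R u"] triple[of z]
      by (simp add: scaleR_small_numeral(2-) scaleR_2 add.assoc add.left_commute)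
    then show ?thesis
      using even_double[of "(1/2) *\<^sub>R u"] by (simp add: eq_diff_eq[symmetric])
  qed
  have odd: "A u + A (- u) = 0" for u
  proof -
    define E where "E = A u + A (- u)"
    \<comment> \<open>Adding these gives \<open>4 *\<^sub>R E\<close> for the defect at
      \<open>2 *\<^sub>R u\<close>, whereas \<open>even_double\<close> gives
      \<open>- E\<close>.\<close>
    have "A (2 *\<^sub>R u) = A u + A u + E" "A (- (2 *\<^sub>R u)) = A (- u) + A (- u) + E"
      using quad[of u u] quad[of "-u" "-u"] A0
      by (simp_all add: scaleR_2 E_def add.commute)
    then have "A u + A u + E + (A (- u) + A (- u) + E) + E = 0"
      using even_double[of u] by (simp add: E_def)
    then have "5 *\<^sub>R E = 0"
      by (simp add: scaleR_small_numeral E_def algebra_simps)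
    then show ?thesis by (simp add: E_def)
  qed
  show ?thesis
  proof
    fix x y
    have "A (x + y) + A (x - y) = 2 *\<^sub>R A x" "A (x + y) + A (y - x) = 2 *\<^sub>R A y"
      using quad[of x y] quad[of y x] odd by (simp_all add: add.commute)
    moreover have "A (y - x) = - A (x - y)"
      using odd[of "x - y"] by (simp add: add_eq_0_iff)
    ultimately have "2 *\<^sub>R (A x + A y) = A (x + y) + A (x - y) + (A (x + y) - A (x - y))"
      by (simp add: scaleR_add_right)
    then have "2 *\<^sub>R (A x + A y) = 2 *\<^sub>R A (x + y)"
      by (simp add: scaleR_2)
    then show "A (x + y) = A x + A y" by simp
  qed
qed

lemma D_scaled:
  "D (\<lambda>u. c *\<^sub>R f (d *\<^sub>R u)) x y z = c *\<^sub>R D f (d *\<^sub>R x) (d *\<^sub>R y) (d *\<^sub>R z)"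
  by (simp add: D_def scaleR_add_right scaleR_diff_right mult.commute)

theorem theorem5p1:
  fixes N :: "'b::real_vector \<Rightarrow> real \<Rightarrow> real"
    and \<phi> :: "'a::real_vector \<Rightarrow> 'a \<Rightarrow> 'a \<Rightarrow> real"
    and f :: "'a \<Rightarrow> 'b"
  assumes "fuzzy_banach_space N"
    and "\<And>x y z. \<phi> x y z \<ge> 0"
    and "\<And>x y z. summable (phi_term \<phi> x y z)"
    and "uniformly_approx_affine N \<phi> f"
  shows "\<exists>A. (\<forall>x. fuzzy_tendsto N (\<lambda>n. (1 / 3 ^ n) *\<^sub>R f (3 ^ n *\<^sub>R x)) (A x)) \<and>
    affine_mapping A \<and>
    (\<forall>\<alpha>>0. \<forall>\<delta>>0.
      (\<forall>x y z. N (D f x y z) (\<delta> * \<phi> x y z) > \<alpha>) \<longrightarrow>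
      (\<forall>x. N (f x - A x - f 0) (\<delta> / 3 * phi_tilde \<phi> 0 0 x) > \<alpha>))"
proof -
  interpret fuzzy_banach_space N by (rule assms(1))
  \<comment> \<open>\<open>g\<close> is the sequence that telescopes, \<open>h\<close> the one in
    the claim; they differ by \<open>f 0 / 3 ^ n\<close>, which tends to 0.\<close>
  define g where "g x n = (1 / 3 ^ n) *\<^sub>R (f (3 ^ n *\<^sub>R x) - f 0)" for x and n :: nat
  define h where "h n x = (1 / 3 ^ n) *\<^sub>R f (3 ^ n *\<^sub>R x)" for x and n :: nat
  \<comment> \<open>Halving \<epsilon> turns the weak bound into the strict one that the telescoping
    estimate takes.\<close>
  have approx: "\<exists>t0>0. \<forall>x y z. N (D f x y z) (t0 * \<phi> x y z) > 1 - \<epsilon>" if "\<epsilon> > 0" for \<epsilon>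
  proof -
    have "\<epsilon> / 2 > 0" using that by simp
    then obtain t0 where t0: "t0 > 0" "\<forall>x y z. \<forall>t\<ge>t0. N (D f x y z) (t * \<phi> x y z) \<ge> 1 - \<epsilon> / 2"
      using assms(4) unfolding uniformly_approx_affine_def by blast
    have "N (D f x y z) (t0 * \<phi> x y z) > 1 - \<epsilon>" for x y z
      using t0(2)[rule_format, of t0 x y z] that by simp
    with t0(1) show ?thesis by blast
  qed
  have null3: "(\<lambda>n. 1 / 3 ^ n :: real) \<longlonglongrightarrow> 0"
    using LIMSEQ_power_zero[of "1/3 :: real"] by (simp add: power_one_over)

  \<comment> \<open>Existence of the limit\<close>
  have "fuzzy_Cauchy N (g x)" for x
    unfolding fuzzy_Cauchy_def
  proof (intro allI impI)
    fix \<epsilon> \<delta> :: real assume "\<epsilon> > 0" "\<delta> > 0"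
    obtain t0 where t0: "t0 > 0" "\<And>x y z. N (D f x y z) (t0 * \<phi> x y z) > 1 - \<epsilon>"
      using approx[OF \<open>\<epsilon> > 0\<close>] by blast
    \<comment> \<open>The telescoped parameter is \<open>t0 / 3\<close> times a block of the series,
      so this threshold keeps it below \<delta>.\<close>
    have "3 * \<delta> / t0 > 0" using \<open>\<delta> > 0\<close> t0(1) by simp
    then obtain n0 where n0: "\<And>m n. m \<ge> n0 \<Longrightarrow> norm (sum (phi_term \<phi> 0 0 x) {m..<n}) < 3 * \<delta> / t0"
      using assms(3)[of 0 0 x, unfolded summable_Cauchy] by blast
    have less: "N (g x n - g x m) \<delta> > 1 - \<epsilon>" if "m < n" "m \<ge> n0" for m n
    proof -
      let ?S = "\<Sum>k = m..<n. t0 * \<phi> 0 0 (3 ^ k *\<^sub>R x) / 3 ^ Suc k"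
      have "?S = t0 / 3 * sum (phi_term \<phi> 0 0 x) {m..<n}"
        by (simp add: phi_term_def sum_distrib_left)
      also have "\<dots> \<le> \<delta>"
        using n0[of m n] that t0(1) by (simp add: field_simps abs_less_iff)
      finally have "N (g x n - g x m) ?S \<le> N (g x n - g x m) \<delta>"
        by (rule N_mono)
      moreover have "N (g x n - g x m) ?S > 1 - \<epsilon>"
        unfolding g_def using that(1) t0(2) by (rule N_scaled_diff_greater)
      ultimately show ?thesis by linarith
    qed
    have "N (g x m - g x n) \<delta> > 1 - \<epsilon>" if "m \<ge> n0" "n \<ge> n0" for m n
      using less[of m n] less[of n m] that \<open>\<epsilon> > 0\<close> \<open>\<delta> > 0\<close> N_minus[of "g x n - g x m"] N_zero
      by (cases m n rule: linorder_cases) auto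
    then show "\<exists>n0. \<forall>m\<ge>n0. \<forall>n\<ge>n0. N (g x m - g x n) \<delta> > 1 - \<epsilon>" by blast
  qed
  then have "\<forall>x. \<exists>l. fuzzy_tendsto N (g x) l"
    using complete unfolding fuzzy_convergent_def by blast
  from choice[OF this] obtain A where A: "\<And>x. fuzzy_tendsto N (g x) (A x)"
    by blast

  have lim: "fuzzy_tendsto N (\<lambda>n. h n x) (A x)" for x
  proof -
    have "fuzzy_tendsto N (\<lambda>n. g x n + (1 / 3 ^ n) *\<^sub>R f 0) (A x + 0)"
      by (intro fuzzy_tendsto_add A fuzzy_tendsto_scaleR_null null3) simp
    then show ?thesis by (simp add: g_def h_def algebra_simps)
  qed

  \<comment> \<open>Additivity of the limit\<close>
  have "D A x y z = 0" for x y z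
  proof -
    have "fuzzy_tendsto N (\<lambda>n. D (h n) x y z) (D A x y z)"
      unfolding D_def by (intro fuzzy_tendsto_add fuzzy_tendsto_diff fuzzy_tendsto_scaleR lim)
    moreover have "fuzzy_tendsto N (\<lambda>n. D (h n) x y z) 0"
    proof (rule fuzzy_tendstoI)
      fix t \<epsilon> :: real assume "t > 0" "\<epsilon> > 0"
      obtain t0 where t0: "t0 > 0" "\<And>x y z. N (D f x y z) (t0 * \<phi> x y z) > 1 - \<epsilon>"
        using approx[OF \<open>\<epsilon> > 0\<close>] by blast
      \<comment> \<open>Terms of a convergent series tend to 0, so the scaled parameter
        \<open>t0 * phi_term \<phi> x y z n\<close> eventually falls below \<open>t\<close>.\<close>
      have "\<forall>\<^sub>F n in sequentially. phi_term \<phi> x y z n < t / t0"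
        using order_tendstoD(2)[OF summable_LIMSEQ_zero[OF assms(3)]] \<open>t > 0\<close> t0(1) by simp
      then show "\<forall>\<^sub>F n in sequentially. N (D (h n) x y z - 0) t > 1 - \<epsilon>"
      proof eventually_elim
        case (elim n)
        let ?D = "D f (3 ^ n *\<^sub>R x) (3 ^ n *\<^sub>R y) (3 ^ n *\<^sub>R z)"
        have "t0 * \<phi> (3 ^ n *\<^sub>R x) (3 ^ n *\<^sub>R y) (3 ^ n *\<^sub>R z) \<le> t * 3 ^ n"
          using elim t0(1) by (simp add: phi_term_def field_simps)
        then have "N ?D (t * 3 ^ n) > 1 - \<epsilon>"
          using less_le_trans[OF t0(2) N_mono] by blast
        then show ?case
          using N3[of "1 / 3 ^ n" ?D t] by (simp add: h_def[abs_def] D_scaled)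
      qed
    qed
    ultimately show ?thesis by (rule fuzzy_tendsto_unique)
  qed
  moreover have "A 0 = 0"
  proof -
    have "fuzzy_tendsto N (g 0) 0"
      by (simp add: g_def[abs_def] fuzzy_tendsto_def N_zero)
    then show ?thesis using A fuzzy_tendsto_unique by blast
  qed
  ultimately have "additive A" by (rule additive_if_D_eq_0)
  then have "affine_mapping A"
    unfolding affine_mapping_def by (intro exI[of _ 0] exI[of _ A]) simp

  \<comment> \<open>The error estimate\<close>
  moreover have "N (f x - A x - f 0) (\<delta> / 3 * phi_tilde \<phi> 0 0 x) > \<alpha>"
    if "\<alpha> > 0" and bound: "\<And>x y z. N (D f x y z) (\<delta> * \<phi> x y z) > \<alpha>" and "\<delta> > 0" for \<alpha> \<delta> x
  proof -
    have "\<alpha> < 1" using less_le_trans[OF bound N_le_1] .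
    obtain s where s: "s < \<delta> * \<phi> 0 0 x" "N (D f 0 0 x) s > \<alpha>"
      using N_greater_shrink[OF bound \<open>\<alpha> > 0\<close>] by blast
    \<comment> \<open>Lowering the first bound to \<open>s\<close> frees exactly \<open>e\<close> in
      the total, since the summand for \<open>k = 0\<close> has weight 1/3.\<close>
    define e where "e = (\<delta> * \<phi> 0 0 x - s) / 3"
    define r where "r k = (if k = 0 then s else \<delta> * \<phi> 0 0 (3 ^ k *\<^sub>R x))" for k :: nat
    have "e > 0" using s by (simp add: e_def)
    \<comment> \<open>The condition \<open>n > 0\<close> ensures that the tightened summand
      \<open>k = 0\<close> occurs in the sum.\<close>
    then have "\<forall>\<^sub>F n in sequentially. n > 0 \<and> N (g x n - A x) e > \<alpha>"
      using A \<open>\<alpha> < 1\<close> by (intro eventually_conj eventually_gt_at_top fuzzy_tendstoD)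
    then obtain n where n: "n > 0" "N (g x n - A x) e > \<alpha>"
      using eventually_happens'[OF sequentially_bot] by blast
    have "N (g x n - g x 0) (\<Sum>k = 0..<n. r k / 3 ^ Suc k) > \<alpha>"
      unfolding g_def using n(1) by (rule N_scaled_diff_greater) (auto simp: r_def s bound)
    then have "N (g x 0 - g x n) (\<Sum>k = 0..<n. r k / 3 ^ Suc k) > \<alpha>"
      using N_minus[of "g x n - g x 0"] by simp
    from N_add_greater[OF this n(2)]
    have "N (g x 0 - A x) ((\<Sum>k = 0..<n. r k / 3 ^ Suc k) + e) > \<alpha>"
      by simp
    moreover have "(\<Sum>k = 0..<n. r k / 3 ^ Suc k) + e \<le> \<delta> / 3 * phi_tilde \<phi> 0 0 x"
    proof -
      \<comment> \<open>Adding \<open>e\<close> restores the first summand, leaving a partial sum of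
        a series with nonnegative terms.\<close>
      have "(\<Sum>k = 0..<n. r k / 3 ^ Suc k) + e = (\<Sum>k = 0..<n. \<delta> / 3 * phi_term \<phi> 0 0 x k)"
        using n(1) by (simp add: sum.atLeast_Suc_lessThan r_def e_def phi_term_def field_simps)
      also have "\<dots> = \<delta> / 3 * (\<Sum>k = 0..<n. phi_term \<phi> 0 0 x k)"
        by (simp add: sum_distrib_left)
      also have "(\<Sum>k = 0..<n. phi_term \<phi> 0 0 x k) \<le> phi_tilde \<phi> 0 0 x"
        unfolding phi_tilde_def
        using assms(2) by (intro sum_le_suminf assms(3)) (auto simp: phi_term_def)
      finally show ?thesis using \<open>\<delta> > 0\<close> by simp
    qed
    ultimately have "N (g x 0 - A x) (\<delta> / 3 * phi_tilde \<phi> 0 0 x) > \<alpha>"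
      using less_le_trans[OF _ N_mono] by blast
    then show ?thesis by (simp add: g_def algebra_simps)
  qed
  ultimately show ?thesis
    using lim unfolding h_def by blast
qed

end
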